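(* Let $A$ be a left brace (finite or infinite). Then the following assertions are equivalent: 1. $A^{(n)}=0$ and $A^{m}=0$ for some natural numbers $m,n$. 2. $A^{[n]}=0$ for some natural number $n$. 3. $A^{(n)}=0$ for some natural number $n$ and the adjoint group $A^{\circ}$ is nilpotent. 4. The adjoint group $A^{\circ}$ is nilpotent, and the solution $(A,r)$ of the Yang-Baxter equation associated to $A$ is a multipermutation solution.
   Context: A left brace is an abelian group $(A,+)$ with a left distributive multiplication $\cdot$, i.e. $a(b+c)=ab+ac$ for all $a,b,c\in A$ (the multiplication is not assumed associative or right distributive), such that the circle operation $a\circ b=ab+a+b$ makes $A$ into a group. The group $A^{\circ}=(A,\circ)$ is the adjoint group of $A$. For subsets $C,D\subseteq A$, $C\cdot D$ denotes the set of all finite sums $\sum_i c_id_i$ with $c_i\in C$, $d_i\in D$. Define - $A^{1}=A$, $A^{n+1}=A\cdot A^{n}$; - $A^{(1)}=A$, $A^{(n+1)}=A^{(n)}\cdot A$; - $A^{[1]}=A$, $A^{[n+1]}=\sum_{i=1}^{n}A^{[i]}\cdot A^{[n+1-i]}$. The solution of the Yang-Baxter equation associated to the left brace $A$ is the map $r:A\times A\to A\times A$, $r(x,y)=(u,v)$ with $u=x\cdot y+y$ and $v=z\cdot x+x$, where $z$ is the inverse of $u$ in the group $A^{\circ}$; it is a non-degenerate involutive set-theoretic solution. For a non-degenerate involutive set-theoretic solution $(X,r)$ with $r(x,y)=(\sigma_x(y),\gamma_y(x))$, the retraction $\mathrm{Ret}(X,r)$ is the solution induced by $r$ on the quotient set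 $X/{\sim}$, where $x\sim y$ if and only if $\sigma_x=\sigma_y$. The solution $(X,r)$ is a multipermutation solution (of level $m$) if there is a nonnegative integer $m$ (the smallest such) such that the solution obtained after applying the retraction $m$ times has cardinality $1$. *)

theory Defs
  imports "HOL-Algebra.Generated_Groups" "HOL-Library.Disjoint_Sets"
begin

section \<open>Nilpotent groups\<close>

primrec lower_central :: "('a, 'b) monoid_scheme \<Rightarrow> nat \<Rightarrow> 'a set" where
  "lower_central G 0 = carrier G"
| "lower_central G (Suc n) =
     generate G (\<Union>h \<in> lower_central G n. \<Union>g \<in> carrier G.
       {h \<otimes>\<^bsub>G\<^esub> g \<otimes>\<^bsub>G\<^esub> inv\<^bsub>G\<^esub> h \<otimes>\<^bsub>G\<^esub> inv\<^bsub>G\<^esub> g})"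

definition nilpotent_group :: "('a, 'b) monoid_scheme \<Rightarrow> bool" where
  "nilpotent_group G \<longleftrightarrow> group G \<and> (\<exists>n. lower_central G n = {\<one>\<^bsub>G\<^esub>})"


section \<open>Left braces\<close>

text \<open>
  The brace is the whole type; its addition is the type-class one and its multiplication is a
  parameter. In \<open>adjoint_group\<close> the unit may be fixed to be \<open>0\<close>: left distributivity gives
  \<open>a \<cdot> 0 = 0\<close>, so \<open>0\<close> is always a right unit of the circle operation and hence the unit
  whenever that operation is a group operation.
\<close>

definition circ :: "('a::ab_group_add \<Rightarrow> 'a \<Rightarrow> 'a) \<Rightarrow> 'a \<Rightarrow> 'a \<Rightarrow> 'a" where
  "circ m a b = m a b + a + b"

definition adjoint_group :: "('a::ab_group_add \<Rightarrow> 'a \<Rightarrow> 'a) \<Rightarrow> 'a monoid" where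
  "adjoint_group m = \<lparr>carrier = UNIV, monoid.mult = circ m, one = 0\<rparr>"

locale left_brace =
  fixes m :: "'a::ab_group_add \<Rightarrow> 'a \<Rightarrow> 'a"  (infixl "\<cdot>" 70)
  assumes distrib: "a \<cdot> (b + c) = a \<cdot> b + a \<cdot> c"
    and adjoint: "group (adjoint_group m)"

definition set_mult_sums :: "('a::ab_group_add \<Rightarrow> 'a \<Rightarrow> 'a) \<Rightarrow> 'a set \<Rightarrow> 'a set \<Rightarrow> 'a set" where
  "set_mult_sums m C D = {(\<Sum>(c, d)\<leftarrow>ps. m c d) |ps. set ps \<subseteq> C \<times> D}"

text \<open>
  The series \<open>A\<^sup>n\<close>, \<open>A\<^sup>(\<^sup>n\<^sup>)\<close> and \<open>A\<^sup>[\<^sup>n\<^sup>]\<close> start at index 1; the value at index 0 carries no meaning.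
\<close>

fun left_series :: "('a::ab_group_add \<Rightarrow> 'a \<Rightarrow> 'a) \<Rightarrow> nat \<Rightarrow> 'a set" where
  "left_series m 0 = UNIV"
| "left_series m (Suc 0) = UNIV"
| "left_series m (Suc (Suc n)) = set_mult_sums m UNIV (left_series m (Suc n))"

fun right_series :: "('a::ab_group_add \<Rightarrow> 'a \<Rightarrow> 'a) \<Rightarrow> nat \<Rightarrow> 'a set" where
  "right_series m 0 = UNIV"
| "right_series m (Suc 0) = UNIV"
| "right_series m (Suc (Suc n)) = set_mult_sums m (right_series m (Suc n)) UNIV"

fun bracket_series :: "('a::ab_group_add \<Rightarrow> 'a \<Rightarrow> 'a) \<Rightarrow> nat \<Rightarrow> 'a set" where
  "bracket_series m 0 = UNIV"
| "bracket_series m (Suc 0) = UNIV"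
| "bracket_series m (Suc (Suc n)) =
     {(\<Sum>i = 1..Suc n. x i) |x. \<forall>i \<in> {1..Suc n}.
        x i \<in> set_mult_sums m (bracket_series m i) (bracket_series m (Suc (Suc n) - i))}"


section \<open>Set-theoretic solutions of the Yang-Baxter equation\<close>

definition sigma :: "('x \<times> 'x \<Rightarrow> 'x \<times> 'x) \<Rightarrow> 'x \<Rightarrow> 'x \<Rightarrow> 'x" where
  "sigma r x y = fst (r (x, y))"

definition gamma :: "('x \<times> 'x \<Rightarrow> 'x \<times> 'x) \<Rightarrow> 'x \<Rightarrow> 'x \<Rightarrow> 'x" where
  "gamma r y x = snd (r (x, y))"

definition on12 :: "('x \<times> 'x \<Rightarrow> 'x \<times> 'x) \<Rightarrow> 'x \<times> 'x \<times> 'x \<Rightarrow> 'x \<times> 'x \<times> 'x" where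
  "on12 r = (\<lambda>(x, y, z). (sigma r x y, gamma r y x, z))"

definition on23 :: "('x \<times> 'x \<Rightarrow> 'x \<times> 'x) \<Rightarrow> 'x \<times> 'x \<times> 'x \<Rightarrow> 'x \<times> 'x \<times> 'x" where
  "on23 r = (\<lambda>(x, y, z). (x, sigma r y z, gamma r z y))"

locale nondegenerate_involutive_solution =
  fixes X :: "'x set" and r :: "'x \<times> 'x \<Rightarrow> 'x \<times> 'x"
  assumes maps_to: "r \<in> X \<times> X \<rightarrow> X \<times> X"
    and yang_baxter: "t \<in> X \<times> X \<times> X \<Longrightarrow> on12 r (on23 r (on12 r t)) = on23 r (on12 r (on23 r t))"
    and involutive: "p \<in> X \<times> X \<Longrightarrow> r (r p) = p"
    and sigma_bij: "x \<in> X \<Longrightarrow> bij_betw (sigma r x) X X"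
    and gamma_bij: "y \<in> X \<Longrightarrow> bij_betw (gamma r y) X X"


section \<open>Retraction and multipermutation solutions\<close>

definition ret_rel :: "'x set \<Rightarrow> ('x \<times> 'x \<Rightarrow> 'x \<times> 'x) \<Rightarrow> ('x \<times> 'x) set" where
  "ret_rel X r = {(x, y) \<in> X \<times> X. \<forall>z \<in> X. sigma r x z = sigma r y z}"

text \<open>
  The unions in \<open>ret\<close> are the usual way to define a map on classes: for a non-degenerate
  involutive solution all members of each union coincide.
\<close>

definition ret :: "'x set \<times> ('x \<times> 'x \<Rightarrow> 'x \<times> 'x)
    \<Rightarrow> 'x set set \<times> ('x set \<times> 'x set \<Rightarrow> 'x set \<times> 'x set)" where
  "ret = (\<lambda>(X, r). (X // ret_rel X r,
     \<lambda>(C, D). (\<Union>x \<in> C. \<Union>y \<in> D. ret_rel X r `` {sigma r x y},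
               \<Union>x \<in> C. \<Union>y \<in> D. ret_rel X r `` {gamma r y x})))"

definition transport :: "('x \<Rightarrow> 'y) \<Rightarrow> 'x set \<times> ('x \<times> 'x \<Rightarrow> 'x \<times> 'x)
    \<Rightarrow> 'y set \<times> ('y \<times> 'y \<Rightarrow> 'y \<times> 'y)" where
  "transport f = (\<lambda>(X, r).
     (f ` X, \<lambda>(u, v). map_prod f f (r (inv_into X f u, inv_into X f v))))"

text \<open>
  Each application of \<open>ret\<close> changes the type of the points from \<open>'x\<close> to \<open>'x set\<close>. To iterate it,
  the points of every iterated retraction are kept as blocks of a partition of the original
  set: points become singletons, and a class of blocks is identified with its union. Lemma
  \<open>inj_on_Union_ret\<close> below shows that this identification is injective, so \<open>transport\<close> only
  replaces a solution by an isomorphic copy.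
\<close>

primrec ret_iter :: "nat \<Rightarrow> 'x set \<times> ('x \<times> 'x \<Rightarrow> 'x \<times> 'x)
    \<Rightarrow> 'x set set \<times> ('x set \<times> 'x set \<Rightarrow> 'x set \<times> 'x set)" where
  "ret_iter 0 S = transport (\<lambda>x. {x}) S"
| "ret_iter (Suc k) S = transport Union (ret (ret_iter k S))"

definition multipermutation_solution :: "'x set \<Rightarrow> ('x \<times> 'x \<Rightarrow> 'x \<times> 'x) \<Rightarrow> bool" where
  "multipermutation_solution X r \<longleftrightarrow>
     nondegenerate_involutive_solution X r \<and> (\<exists>k. card (fst (ret_iter k (X, r))) = 1)"

definition brace_solution :: "('a::ab_group_add \<Rightarrow> 'a \<Rightarrow> 'a) \<Rightarrow> 'a \<times> 'a \<Rightarrow> 'a \<times> 'a" where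
  "brace_solution m = (\<lambda>(x, y).
     let u = m x y + y; z = inv\<^bsub>adjoint_group m\<^esub> u in (u, m z x + x))"

lemma equiv_ret_rel: "equiv X (ret_rel X r)"
  by (rule equivI) (auto simp: ret_rel_def refl_on_def sym_def trans_def)

lemma fst_ret: "fst (ret S) = fst S // ret_rel (fst S) (snd S)"
  by (simp add: ret_def split: prod.split)

lemma inj_on_Union_quotient:
  assumes "equiv P R" "disjoint P" "{} \<notin> P"
  shows "inj_on Union (P // R)"
proof (rule inj_onI)
  have sub: "C \<subseteq> D" if "C \<in> P // R" "D \<in> P // R" "\<Union>C = \<Union>D" for C D
  proof
    fix B assume B: "B \<in> C"
    have P: "C \<subseteq> P" "D \<subseteq> P"
      using that assms(1) by (simp_all add: in_quotient_imp_subset)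
    have "B \<noteq> {}" using B P(1) assms(3) by auto
    then obtain b where b: "b \<in> B" by auto
    then have "b \<in> \<Union>D" using B that(3) by auto
    then obtain B' where B': "B' \<in> D" "b \<in> B'" by auto
    have "B \<in> P" "B' \<in> P" using B B'(1) P by auto
    then have "B = B'" using disjointD[OF assms(2), of B B'] b B'(2) by auto
    with B' show "B \<in> D" by simp
  qed
  fix C D assume "C \<in> P // R" "D \<in> P // R" "\<Union>C = \<Union>D"
  then show "C = D" using sub[of C D] sub[of D C] by auto
qed

lemma partition_ret_iter:
  "disjoint (fst (ret_iter k S)) \<and> {} \<notin> fst (ret_iter k S) \<and> \<Union>(fst (ret_iter k S)) = fst S"
proof (induction k)
  case 0
  then show ?case by (auto simp: transport_def disjoint_def split: prod.splits)
next
  case (Suc k)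
  define P where "P = fst (ret_iter k S)"
  define R where "R = ret_rel P (snd (ret_iter k S))"
  have P: "disjoint P" "{} \<notin> P" "\<Union>P = fst S" using Suc by (auto simp: P_def)
  have R: "equiv P R" by (simp add: R_def equiv_ret_rel)
  have eq: "fst (ret_iter (Suc k) S) = Union ` (P // R)"
    by (simp add: transport_def fst_ret P_def R_def split_beta)
  have "disjoint (Union ` (P // R))"
  proof (unfold disjoint_def, intro ballI impI)
    fix U V assume "U \<in> Union ` (P // R)" "V \<in> Union ` (P // R)" and ne: "U \<noteq> V"
    then obtain C D where CD: "C \<in> P // R" "D \<in> P // R" "U = \<Union>C" "V = \<Union>D" by blast
    then have "C \<inter> D = {}" using quotient_disj[OF R] ne by blast
    moreover have "C \<subseteq> P" "D \<subseteq> P"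
      using CD R by (simp_all add: in_quotient_imp_subset)
    ultimately have "B \<inter> B' = {}" if "B \<in> C" "B' \<in> D" for B B'
      using disjointD[OF P(1), of B B'] that by auto
    then show "U \<inter> V = {}" unfolding CD(3,4) by blast
  qed
  moreover have "{} \<notin> Union ` (P // R)"
  proof
    assume "{} \<in> Union ` (P // R)"
    then obtain C where C: "C \<in> P // R" "\<Union>C = {}" by auto
    then have "C \<noteq> {}" "C \<subseteq> P"
      using R by (simp_all add: in_quotient_imp_subset in_quotient_imp_non_empty)
    with C P(2) show False by auto
  qed
  moreover have "\<Union>(Union ` (P // R)) = \<Union>(\<Union>(P // R))" by auto
  then have "\<Union>(Union ` (P // R)) = fst S"
    by (simp only: Union_quotient[OF R] P(3))
  ultimately show ?case unfolding eq by blast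
qed

lemma inj_on_Union_ret: "inj_on Union (fst (ret (ret_iter k S)))"
  using partition_ret_iter[of k S] by (simp add: fst_ret inj_on_Union_quotient equiv_ret_rel)

end

theory Submission
  imports Defs
begin

text \<open>
  Write \<open>S\<^sub>0 = 0\<close> and \<open>S\<^sub>k\<^sub>+\<^sub>1 = {a. a \<cdot> A \<subseteq> S\<^sub>k}\<close> for the socle series. All its terms are ideals
  (\<open>brace_ideal_socle\<close>), and it measures two of the conditions at once. It reaches \<open>A\<close> exactly
  when some \<open>A\<^sup>(\<^sup>n\<^sup>)\<close> vanishes (\<open>right_series_zero_iff_socle_series\<close>); and the \<open>k\<close>-th retraction
  of the solution of \<open>A\<close> is the solution induced on the cosets of \<open>S\<^sub>k\<close>
  (\<open>ret_iter_brace_solution\<close>), because \<open>x\<close> and \<open>y\<close> act in the same way on \<open>A\<close> modulo \<open>S\<^sub>k\<close> iff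
  \<open>x - y \<in> S\<^sub>k\<^sub>+\<^sub>1\<close>. Hence the solution is a multipermutation solution iff some \<open>A\<^sup>(\<^sup>n\<^sup>)\<close> vanishes.

  Both one-sided series lie in \<open>A\<^sup>[\<^sup>n\<^sup>]\<close>, so bracket nilpotency gives left and right nilpotency.
  Conversely, suppose \<open>A\<^sup>M = 0\<close> and that \<open>A\<^sup>[\<^sup>j\<^sup>]\<close> lies in \<open>S\<^sub>k\<^sub>+\<^sub>1\<close> for all large \<open>j\<close>. Modulo \<open>S\<^sub>k\<close> a
  product \<open>a \<cdot> b\<close> with \<open>a\<close> deep in the bracket series is zero, so in a deep bracket all the depth
  must sit in the right factor; unfolding that factor repeatedly gives elements of
  \<open>A \<cdot> (A \<cdot> (A \<cdot> \<dots>))\<close>, hence of \<open>A\<^sup>M = 0\<close>. So the brackets eventually fall into \<open>S\<^sub>k\<close>, and going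
  down the socle series they eventually vanish (\<open>bracket_series_eventually_zero\<close>).

  For the adjoint group, the commutator of \<open>h\<close> and \<open>g\<close> lies in an ideal as soon as
  \<open>h \<cdot> g - g \<cdot> h\<close> does. If some \<open>A\<^sup>[\<^sup>n\<^sup>]\<close> vanishes, the series of two-sided annihilators reaches
  \<open>A\<close>, and it is then a central series of the adjoint group
  (\<open>annihilator_series_imp_nilpotent\<close>). In the other direction, an element \<open>g\<close> of \<open>S\<^sub>k\<^sub>+\<^sub>1\<close>
  satisfies \<open>g \<cdot> a \<in> S\<^sub>k\<close>, so modulo \<open>S\<^sub>k\<close> the product \<open>a \<cdot> g\<close> is the inverse of the commutator
  of \<open>g\<close> and \<open>a\<close>. Left multiplication by \<open>A\<close> therefore moves \<open>g\<close> down the lower central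
  series, and nilpotency of the adjoint group forces the left series from \<open>S\<^sub>k\<^sub>+\<^sub>1\<close> into \<open>S\<^sub>k\<close>
  (\<open>left_series_descent\<close>).
\<close>

section \<open>The adjoint group and its action on the additive group\<close>

context left_brace
begin

abbreviation adj :: "'a \<Rightarrow> 'a \<Rightarrow> 'a" (infixl "\<odot>" 70) where
  "a \<odot> b \<equiv> circ m a b"

abbreviation adj_inv :: "'a \<Rightarrow> 'a" where
  "adj_inv a \<equiv> inv\<^bsub>adjoint_group m\<^esub> a"

definition lam :: "'a \<Rightarrow> 'a \<Rightarrow> 'a" where
  "lam a b = a \<cdot> b + b"

lemma adjoint_group_simps [simp]:
  "carrier (adjoint_group m) = UNIV"
  "x \<otimes>\<^bsub>adjoint_group m\<^esub> y = x \<odot> y"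
  "\<one>\<^bsub>adjoint_group m\<^esub> = 0"
  by (simp_all add: adjoint_group_def)

lemma adj_assoc: "(a \<odot> b) \<odot> c = a \<odot> (b \<odot> c)"
  using monoid.m_assoc[OF group.is_monoid[OF adjoint], of a b c] by simp

lemma adj_zero [simp]: "0 \<odot> a = a" "a \<odot> 0 = a"
  using monoid.l_one[OF group.is_monoid[OF adjoint], of a]
    monoid.r_one[OF group.is_monoid[OF adjoint], of a] by simp_all

lemma adj_inv [simp]: "adj_inv a \<odot> a = 0" "a \<odot> adj_inv a = 0"
  using group.l_inv[OF adjoint, of a] group.r_inv[OF adjoint, of a] by simp_all

lemma adj_inv_adj_inv [simp]: "adj_inv (adj_inv a) = a"
  using group.inv_inv[OF adjoint, of a] by simp

lemma adj_inv_cancel [simp]: "adj_inv a \<odot> (a \<odot> b) = b" "a \<odot> (adj_inv a \<odot> b) = b"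
  by (simp_all flip: adj_assoc)

lemma adj_inv_adj: "adj_inv (a \<odot> b) = adj_inv b \<odot> adj_inv a"
  using group.inv_mult_group[OF adjoint, of a b] by simp

lemma adj_left_cancel: "a \<odot> b = a \<odot> c \<longleftrightarrow> b = c"
  by (metis adj_inv_cancel(1))

lemma mult_zero_right [simp]: "a \<cdot> 0 = 0"
  using distrib[of a 0 0] by simp

lemma mult_minus_right: "a \<cdot> (- b) = - (a \<cdot> b)"
  using distrib[of a b "- b"] by (simp add: eq_neg_iff_add_eq_0 add.commute)

lemma mult_diff_right: "a \<cdot> (b - c) = a \<cdot> b - a \<cdot> c"
  using distrib[of a b "- c"] by (simp add: mult_minus_right)

lemma adj_eq: "a \<odot> b = a + lam a b"
  by (simp add: circ_def lam_def)

lemma lam_add: "lam a (b + c) = lam a b + lam a c"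
  by (simp add: lam_def distrib)

lemma lam_diff: "lam a (b - c) = lam a b - lam a c"
  by (simp add: lam_def mult_diff_right)

lemma lam_zero [simp]: "lam a 0 = 0"
  by (simp add: lam_def)

lemma lam_by_zero [simp]: "lam 0 b = b"
  using adj_eq[of 0 b] by simp

lemma mult_zero_left [simp]: "0 \<cdot> b = 0"
  using lam_by_zero[of b] by (simp add: lam_def)

text \<open>
  Associativity of the circle operation, read in the additive group, says that \<open>lam\<close> is an action
  of the adjoint group. It replaces the missing associativity of the multiplication.
\<close>

lemma lam_adj: "lam (a \<odot> b) c = lam a (lam b c)"
proof -
  have "a + (lam a b + lam (a \<odot> b) c) = a + (lam a b + lam a (lam b c))"
    using adj_assoc[of a b c] by (simp add: adj_eq lam_add add.assoc)
  then show ?thesis by simp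
qed

lemma lam_inv_cancel [simp]: "lam (adj_inv a) (lam a b) = b" "lam a (lam (adj_inv a) b) = b"
  by (simp_all flip: lam_adj)

lemma lam_adj_inv_self: "lam a (adj_inv a) = - a"
  using adj_eq[of a "adj_inv a"] by (simp add: eq_neg_iff_add_eq_0 add.commute)

text \<open>
  Up to the action, the quotient of two elements in the adjoint group is their additive
  difference. This is why additive and multiplicative cosets of an ideal coincide.
\<close>

lemma adj_inv_adj_eq_lam_diff: "adj_inv y \<odot> x = lam (adj_inv y) (x - y)"
proof -
  have "lam (adj_inv y) y = - adj_inv y" using lam_adj_inv_self[of "adj_inv y"] by simp
  then show ?thesis by (simp add: adj_eq lam_diff)
qed

lemma add_eq_adj: "x + y = x \<odot> lam (adj_inv x) y"
  by (simp add: adj_eq)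


section \<open>Ideals and the socle series\<close>

text \<open>
  Normality in the adjoint group is a consequence of the two closure conditions under
  multiplication (\<open>lam_cong\<close> and \<open>adj_inv_cong\<close> below show that the quotient is well defined).
\<close>

definition brace_ideal :: "'a set \<Rightarrow> bool" where
  "brace_ideal I \<longleftrightarrow> 0 \<in> I \<and> (\<forall>x\<in>I. \<forall>y\<in>I. x - y \<in> I) \<and> (\<forall>x\<in>I. \<forall>a. a \<cdot> x \<in> I \<and> x \<cdot> a \<in> I)"

lemma brace_ideal_zero: "brace_ideal I \<Longrightarrow> 0 \<in> I"
  and brace_ideal_diff: "brace_ideal I \<Longrightarrow> x \<in> I \<Longrightarrow> y \<in> I \<Longrightarrow> x - y \<in> I"
  and brace_ideal_mult_left: "brace_ideal I \<Longrightarrow> x \<in> I \<Longrightarrow> a \<cdot> x \<in> I"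
  and brace_ideal_mult_right: "brace_ideal I \<Longrightarrow> x \<in> I \<Longrightarrow> x \<cdot> a \<in> I"
  by (simp_all add: brace_ideal_def)

lemma brace_ideal_minus: "brace_ideal I \<Longrightarrow> x \<in> I \<Longrightarrow> - x \<in> I"
  using brace_ideal_diff[of I 0 x] by (simp add: brace_ideal_zero)

lemma brace_ideal_add: "brace_ideal I \<Longrightarrow> x \<in> I \<Longrightarrow> y \<in> I \<Longrightarrow> x + y \<in> I"
  using brace_ideal_diff[of I x "- y"] by (simp add: brace_ideal_minus)

lemma brace_ideal_lam: "brace_ideal I \<Longrightarrow> x \<in> I \<Longrightarrow> lam a x \<in> I"
  by (simp add: lam_def brace_ideal_add brace_ideal_mult_left)

lemma brace_ideal_lam_iff: "brace_ideal I \<Longrightarrow> lam a x \<in> I \<longleftrightarrow> x \<in> I"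
  by (metis brace_ideal_lam lam_inv_cancel(1))

lemma brace_ideal_adj: "brace_ideal I \<Longrightarrow> x \<in> I \<Longrightarrow> y \<in> I \<Longrightarrow> x \<odot> y \<in> I"
  by (simp add: adj_eq brace_ideal_add brace_ideal_lam)

lemma brace_ideal_adj_inv: "brace_ideal I \<Longrightarrow> x \<in> I \<Longrightarrow> adj_inv x \<in> I"
  using brace_ideal_lam_iff[of I x "adj_inv x"] by (simp add: lam_adj_inv_self brace_ideal_minus)

lemma cong_sym: "brace_ideal I \<Longrightarrow> x - y \<in> I \<Longrightarrow> y - x \<in> I"
  using brace_ideal_minus[of I "x - y"] by simp

lemma cong_trans: "brace_ideal I \<Longrightarrow> x - y \<in> I \<Longrightarrow> y - z \<in> I \<Longrightarrow> x - z \<in> I"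
  using brace_ideal_add[of I "x - y" "y - z"] by simp

lemma cong_iff_adj: "brace_ideal I \<Longrightarrow> adj_inv y \<odot> x \<in> I \<longleftrightarrow> x - y \<in> I"
  by (simp add: adj_inv_adj_eq_lam_diff brace_ideal_lam_iff)

lemma lam_cong:
  assumes I: "brace_ideal I" and "x - x' \<in> I" "y - y' \<in> I"
  shows "lam x y - lam x' y' \<in> I"
proof -
  define d where "d = adj_inv x' \<odot> x"
  have d: "d \<in> I" using assms by (simp add: d_def cong_iff_adj)
  have "x = x' \<odot> d" by (simp add: d_def)
  then have "lam x y - lam x' y = lam x' (d \<cdot> y)"
    by (simp add: lam_adj lam_def[of d] lam_add)
  then have "lam x y - lam x' y \<in> I"
    using I d by (simp add: brace_ideal_lam brace_ideal_mult_right)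
  moreover have "lam x' y - lam x' y' \<in> I"
    using I assms(3) by (simp add: brace_ideal_lam flip: lam_diff)
  ultimately show ?thesis using cong_trans[OF I] by blast
qed

lemma adj_inv_cong:
  assumes I: "brace_ideal I" and "x - x' \<in> I"
  shows "adj_inv x - adj_inv x' \<in> I"
proof -
  have "lam x (adj_inv x - adj_inv x') = (lam x' (adj_inv x') - lam x (adj_inv x')) + (x' - x)"
    by (simp add: lam_diff lam_adj_inv_self)
  also have "\<dots> \<in> I"
    by (intro brace_ideal_add[OF I] lam_cong[OF I] cong_sym[OF I assms(2)])
       (simp add: brace_ideal_zero[OF I])
  finally show ?thesis by (simp add: brace_ideal_lam_iff I)
qed

text \<open>
  The set in question is the kernel of the action of the adjoint group on the quotient \<open>A / I\<close>, so
  it is a normal subgroup of the adjoint group. It is stable under the action since, for \<open>x\<close> in the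
  kernel, \<open>lam a x\<close> is congruent to the conjugate of \<open>x\<close> by \<open>a\<close>; stability in turn makes it closed
  under addition, because \<open>x + y\<close> is the circle product of \<open>x\<close> and \<open>lam (adj_inv x) y\<close>.
\<close>

lemma brace_ideal_socle:
  assumes I: "brace_ideal I"
  shows "brace_ideal {a. \<forall>b. a \<cdot> b \<in> I}"
proof -
  define J where "J = {a. \<forall>b. a \<cdot> b \<in> I}"
  have J_iff: "a \<in> J \<longleftrightarrow> (\<forall>b. lam a b - b \<in> I)" for a
    by (simp add: J_def lam_def)
  have I_sub_J: "x \<in> J" if "x \<in> I" for x
    using that I by (simp add: J_def brace_ideal_mult_right)
  have cong_J: "x \<in> J" if "x - y \<in> I" "y \<in> J" for x y
    unfolding J_iff
  proof
    fix b
    have "lam x b - lam y b \<in> I" using lam_cong[OF I that(1), of b b] I by (simp add: brace_ideal_zero)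
    then show "lam x b - b \<in> I" using that(2) cong_trans[OF I] unfolding J_iff by blast
  qed
  have adj_J: "x \<odot> y \<in> J" if "x \<in> J" "y \<in> J" for x y
    unfolding J_iff
  proof
    fix b
    have "lam x (lam y b) - lam y b \<in> I" "lam y b - b \<in> I" using that J_iff by auto
    then show "lam (x \<odot> y) b - b \<in> I" using cong_trans[OF I] by (simp add: lam_adj)
  qed
  have inv_J: "adj_inv x \<in> J" if "x \<in> J" for x
    unfolding J_iff
  proof
    fix b
    have "lam x (lam (adj_inv x) b) - lam (adj_inv x) b \<in> I" using that J_iff by blast
    then show "lam (adj_inv x) b - b \<in> I" using cong_sym[OF I] by simp
  qed
  have conj_J: "a \<odot> x \<odot> adj_inv a \<in> J" if "x \<in> J" for a x
    unfolding J_iff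
  proof
    fix b
    have "lam a (lam x (lam (adj_inv a) b) - lam (adj_inv a) b) \<in> I"
      using that J_iff brace_ideal_lam[OF I] by blast
    then show "lam (a \<odot> x \<odot> adj_inv a) b - b \<in> I" by (simp add: lam_adj lam_diff)
  qed
  have lam_J: "lam a x \<in> J" if "x \<in> J" for a x
  proof (rule cong_J[OF _ conj_J[OF that, of a]])
    have "a \<odot> x \<odot> adj_inv a = a + lam a x + lam a (lam x (adj_inv a))"
      unfolding adj_eq[of "a \<odot> x"] lam_adj by (simp add: adj_eq)
    then have "lam a x - a \<odot> x \<odot> adj_inv a = - lam a (lam x (adj_inv a) - adj_inv a)"
      by (simp add: lam_diff lam_adj_inv_self)
    then show "lam a x - a \<odot> x \<odot> adj_inv a \<in> I"
      using that J_iff brace_ideal_lam[OF I] brace_ideal_minus[OF I] by simp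
  qed
  have add_J: "x + y \<in> J" if "x \<in> J" "y \<in> J" for x y
    unfolding add_eq_adj by (intro adj_J lam_J that)
  have minus_J: "- x \<in> J" if "x \<in> J" for x
    using lam_J[OF inv_J[OF that]] lam_adj_inv_self[of x] by metis
  have "brace_ideal J"
    unfolding brace_ideal_def
  proof (intro conjI ballI allI)
    show "0 \<in> J" by (rule I_sub_J[OF brace_ideal_zero[OF I]])
    show "x - y \<in> J" if "x \<in> J" "y \<in> J" for x y
      using add_J[OF that(1) minus_J[OF that(2)]] by simp
    show "a \<cdot> x \<in> J" if "x \<in> J" for a x
      using add_J[OF lam_J[OF that, of a] minus_J[OF that]] by (simp add: lam_def)
    show "x \<cdot> a \<in> J" if "x \<in> J" for a x
      using that by (intro I_sub_J) (simp add: J_def)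
  qed
  then show ?thesis by (simp add: J_def)
qed

primrec socle_series :: "nat \<Rightarrow> 'a set" where
  "socle_series 0 = {0}"
| "socle_series (Suc k) = {a. \<forall>b. a \<cdot> b \<in> socle_series k}"

lemma brace_ideal_socle_series: "brace_ideal (socle_series k)"
proof (induction k)
  case 0
  show ?case by (simp add: brace_ideal_def)
next
  case (Suc k)
  then show ?case by (simp add: brace_ideal_socle)
qed

lemma socle_series_mono: "socle_series k \<subseteq> socle_series (Suc k)"
  using brace_ideal_mult_right[OF brace_ideal_socle_series] by auto


section \<open>Sums of products and the right series\<close>

lemma set_mult_sums_mem: "c \<in> C \<Longrightarrow> d \<in> D \<Longrightarrow> c \<cdot> d \<in> set_mult_sums m C D"
  unfolding set_mult_sums_def by (rule CollectI, rule exI[of _ "[(c, d)]"]) simp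

lemma zero_in_set_mult_sums: "0 \<in> set_mult_sums m C D"
  unfolding set_mult_sums_def by (rule CollectI, rule exI[of _ "[]"]) simp

lemma set_mult_sums_subset:
  assumes "0 \<in> T" "\<And>x y. x \<in> T \<Longrightarrow> y \<in> T \<Longrightarrow> x + y \<in> T"
    and "\<And>c d. c \<in> C \<Longrightarrow> d \<in> D \<Longrightarrow> c \<cdot> d \<in> T"
  shows "set_mult_sums m C D \<subseteq> T"
proof
  fix x assume "x \<in> set_mult_sums m C D"
  then obtain ps where ps: "set ps \<subseteq> C \<times> D" and x: "x = (\<Sum>(c, d)\<leftarrow>ps. c \<cdot> d)"
    unfolding set_mult_sums_def by blast
  from ps have "(\<Sum>(c, d)\<leftarrow>ps. c \<cdot> d) \<in> T"
    by (induction ps) (auto intro: assms)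
  then show "x \<in> T" by (simp add: x)
qed

lemma set_mult_sums_subset_ideal:
  assumes "brace_ideal I" "\<And>c d. c \<in> C \<Longrightarrow> d \<in> D \<Longrightarrow> c \<cdot> d \<in> I"
  shows "set_mult_sums m C D \<subseteq> I"
  by (intro set_mult_sums_subset brace_ideal_zero brace_ideal_add assms)

lemma set_mult_sums_add:
  assumes "x \<in> set_mult_sums m C D" "y \<in> set_mult_sums m C D"
  shows "x + y \<in> set_mult_sums m C D"
proof -
  obtain ps qs where "set ps \<subseteq> C \<times> D" "x = (\<Sum>(c, d)\<leftarrow>ps. c \<cdot> d)"
    "set qs \<subseteq> C \<times> D" "y = (\<Sum>(c, d)\<leftarrow>qs. c \<cdot> d)"
    using assms unfolding set_mult_sums_def by blast
  then show ?thesis unfolding set_mult_sums_def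
    by (intro CollectI exI[of _ "ps @ qs"]) simp
qed

lemma zero_in_left_series: "0 \<in> left_series m k"
  by (cases "(m, k)" rule: left_series.cases) (simp_all add: zero_in_set_mult_sums)

lemma left_series_add: "x \<in> left_series m k \<Longrightarrow> y \<in> left_series m k \<Longrightarrow> x + y \<in> left_series m k"
  by (cases "(m, k)" rule: left_series.cases) (simp_all add: set_mult_sums_add)

lemma zero_in_right_series: "0 \<in> right_series m k"
  by (cases "(m, k)" rule: right_series.cases) (simp_all add: zero_in_set_mult_sums)

lemma zero_in_bracket_series: "0 \<in> bracket_series m k"
proof -
  consider "k = 0" | "k = Suc 0" | n where "k = Suc (Suc n)"
    by (metis not0_implies_Suc)
  then show ?thesis
  proof cases
    case 3
    then show ?thesis
      by (auto intro!: exI[of _ "\<lambda>_. 0"] zero_in_set_mult_sums)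
  qed simp_all
qed

text \<open>
  Each single summand lies in the sum that defines the bracket series, since the other summands
  contain \<open>0\<close>.
\<close>

lemma set_mult_sums_subset_bracket:
  assumes "i \<ge> 1" "j \<ge> 1"
  shows "set_mult_sums m (bracket_series m i) (bracket_series m j) \<subseteq> bracket_series m (i + j)"
proof
  fix x assume x: "x \<in> set_mult_sums m (bracket_series m i) (bracket_series m j)"
  define n where "n = i + j - 2"
  have n: "i + j = Suc (Suc n)" using assms by (simp add: n_def)
  have "x = (\<Sum>l = 1..Suc n. if l = i then x else 0)"
    using assms n by (simp add: sum.delta)
  moreover have "(if l = i then x else 0) \<in> set_mult_sums m (bracket_series m l) (bracket_series m (Suc (Suc n) - l))" for l
    using x zero_in_set_mult_sums by (simp flip: n)
  ultimately show "x \<in> bracket_series m (i + j)"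
    unfolding n bracket_series.simps by blast
qed

lemma bracket_series_subset:
  assumes "n \<ge> 2" "0 \<in> T" "\<And>x y. x \<in> T \<Longrightarrow> y \<in> T \<Longrightarrow> x + y \<in> T"
    and "\<And>i c d. 1 \<le> i \<Longrightarrow> i < n \<Longrightarrow> c \<in> bracket_series m i \<Longrightarrow> d \<in> bracket_series m (n - i) \<Longrightarrow> c \<cdot> d \<in> T"
  shows "bracket_series m n \<subseteq> T"
proof
  fix y assume y: "y \<in> bracket_series m n"
  obtain k where k: "n = Suc (Suc k)" using assms(1) by (metis One_nat_def Suc_1 Suc_le_D Suc_le_mono)
  obtain x where x: "y = (\<Sum>i = 1..Suc k. x i)"
    "\<And>i. i \<in> {1..Suc k} \<Longrightarrow> x i \<in> set_mult_sums m (bracket_series m i) (bracket_series m (n - i))"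
    using y unfolding k bracket_series.simps by blast
  have x_T: "x i \<in> T" if i: "i \<in> {1..Suc k}" for i
    using x(2)[OF i] set_mult_sums_subset[OF assms(2,3), of "bracket_series m i" "bracket_series m (n - i)"]
      assms(4)[of i] i k by auto
  have "sum x I \<in> T" if "finite I" "I \<subseteq> {1..Suc k}" for I
    using that by (induction I) (simp_all add: assms(2,3) x_T del: atLeastAtMost_iff)
  then show "y \<in> T" unfolding x(1) by blast
qed


text \<open>
  Consider chains of ideals with \<open>C\<^sub>i \<cdot> A \<subseteq> C\<^sub>i\<^sub>+\<^sub>1\<close>. The right series lies below every such chain that
  starts at \<open>A\<close>, and the socle series, read downwards, above every such chain that ends at \<open>0\<close>. So
  each of the two, once it connects \<open>A\<close> with \<open>0\<close>, bounds the other.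
\<close>

lemma right_series_zero_iff_socle_series:
  "(\<exists>n\<ge>1. right_series m n = {0}) \<longleftrightarrow> (\<exists>k. socle_series k = UNIV)"
proof (intro iffI; elim exE conjE)
  have Suc_eq: "right_series m (Suc n) = set_mult_sums m (right_series m n) UNIV" if "n \<ge> 1" for n
    using that by (cases n) simp_all
  {
    fix n :: nat assume n: "1 \<le> n" "right_series m n = {0}"
    have "right_series m (n - i) \<subseteq> socle_series i" if "i < n" for i
      using that
    proof (induction i)
      case (Suc i)
      have "n - i = Suc (n - Suc i)" "n - Suc i \<ge> 1" using Suc.prems by simp_all
      then have "x \<cdot> b \<in> right_series m (n - i)" if "x \<in> right_series m (n - Suc i)" for x b
        using that by (simp add: Suc_eq set_mult_sums_mem)
      then show ?case using Suc by auto
    qed (simp add: n)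
    from this[of "n - 1"] n(1) show "\<exists>k. socle_series k = UNIV" by auto
  next
    fix K assume K: "socle_series K = UNIV"
    have "right_series m (Suc i) \<subseteq> socle_series (K - i)" if "i \<le> K" for i
      using that
    proof (induction i)
      case (Suc i)
      have "K - i = Suc (K - Suc i)" using Suc.prems by simp
      then have "right_series m (Suc i) \<subseteq> {a. \<forall>b. a \<cdot> b \<in> socle_series (K - Suc i)}"
        using Suc by simp
      then show ?case unfolding right_series.simps
        by (intro set_mult_sums_subset_ideal brace_ideal_socle_series) auto
    qed (simp add: K)
    from this[of K] show "\<exists>n\<ge>1. right_series m n = {0}"
      using zero_in_right_series by (intro exI[of _ "Suc K"]) (auto simp del: right_series.simps)
  }
qed


section \<open>Left and right nilpotency against bracket nilpotency\<close>

lemma left_series_Suc: "n \<ge> 1 \<Longrightarrow> left_series m (Suc n) = set_mult_sums m UNIV (left_series m n)"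
  by (cases n) simp_all

lemma set_mult_sums_mono: "C \<subseteq> C' \<Longrightarrow> D \<subseteq> D' \<Longrightarrow> set_mult_sums m C D \<subseteq> set_mult_sums m C' D'"
  unfolding set_mult_sums_def by blast

lemma left_series_subset_bracket_series:
  assumes "n \<ge> 1" shows "left_series m n \<subseteq> bracket_series m n"
  using assms
proof (induction n rule: dec_induct)
  case (step n)
  then have "left_series m (Suc n) \<subseteq> set_mult_sums m (bracket_series m 1) (bracket_series m n)"
    by (simp add: left_series_Suc set_mult_sums_mono)
  also have "\<dots> \<subseteq> bracket_series m (Suc n)"
    using set_mult_sums_subset_bracket[of 1 n] step by simp
  finally show ?case .
qed simp

lemma right_series_subset_bracket_series:
  assumes "n \<ge> 1" shows "right_series m n \<subseteq> bracket_series m n"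
  using assms
proof (induction n rule: dec_induct)
  case (step n)
  then have "right_series m (Suc n) \<subseteq> set_mult_sums m (bracket_series m n) (bracket_series m 1)"
    by (cases n) (simp_all add: set_mult_sums_mono)
  also have "\<dots> \<subseteq> bracket_series m (Suc n)"
    using set_mult_sums_subset_bracket[of n 1] step by simp
  finally show ?case .
qed simp

text \<open>
  One step down the socle series, with an explicit bound. Modulo \<open>S\<^sub>k\<close>, left factors of depth
  at least \<open>s\<close> annihilate everything, so each product loses less than \<open>s\<close> of its depth to the left
  factor: depth \<open>l * s\<close> guarantees \<open>l\<close> nested left multiplications.
\<close>

lemma bracket_series_descent:
  assumes "M \<ge> 1" "left_series m M = {0}"
    and "s \<ge> 1" and s: "\<And>j. j \<ge> s \<Longrightarrow> bracket_series m j \<subseteq> socle_series (Suc k)"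
    and "t \<ge> M * s"
  shows "bracket_series m t \<subseteq> socle_series k"
proof -
  note I = brace_ideal_socle_series[of k]
  \<comment> \<open>the preimage of the left series of the quotient by \<open>socle_series k\<close>\<close>
  define T where "T l = {x. \<exists>y\<in>left_series m l. x - y \<in> socle_series k}" for l
  have zero_T: "0 \<in> T l" for l
    using zero_in_left_series[of l] brace_ideal_zero[OF I] by (force simp: T_def)
  have add_T: "x + x' \<in> T l" if "x \<in> T l" "x' \<in> T l" for x x' l
  proof -
    obtain y y' where "y \<in> left_series m l" "y' \<in> left_series m l"
      "x - y \<in> socle_series k" "x' - y' \<in> socle_series k"
      using \<open>x \<in> T l\<close> \<open>x' \<in> T l\<close> by (auto simp: T_def)
    then have "y + y' \<in> left_series m l" "(x + x') - (y + y') \<in> socle_series k"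
      using left_series_add brace_ideal_add[OF I, of "x - y" "x' - y'"]
      by (auto simp: algebra_simps)
    then show ?thesis by (auto simp: T_def)
  qed
  have "\<forall>t\<ge>l * s. bracket_series m t \<subseteq> T l" if "l \<ge> 1" for l
    using that
  proof (induction l rule: dec_induct)
    case base
    have "x \<in> T 1" for x
      unfolding T_def by (rule CollectI, rule bexI[of _ x]) (simp_all add: brace_ideal_zero[OF I])
    then show ?case by blast
  next
    case (step l)
    show ?case
    proof (intro allI impI bracket_series_subset zero_T add_T)
      fix t assume t: "Suc l * s \<le> t"
      have "l * s \<ge> 1" using step(1) assms(3) by simp
      moreover have "s + l * s \<le> t" using t by simp
      ultimately show "2 \<le> t" using assms(3) by linarith
      fix i c d
      assume i: "1 \<le> i" "i < t" and c: "c \<in> bracket_series m i" and d: "d \<in> bracket_series m (t - i)"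
      show "c \<cdot> d \<in> T (Suc l)"
      proof (cases "i \<ge> s")
        case True
        then have "c \<cdot> d \<in> socle_series k" using s[of i] c by auto
        then show ?thesis using zero_in_left_series[of "Suc l"] by (force simp: T_def)
      next
        case False
        then have "t - i \<ge> l * s" using t by simp
        then obtain y where y: "y \<in> left_series m l" "d - y \<in> socle_series k"
          using step(3) d by (auto simp: T_def)
        then have "c \<cdot> y \<in> left_series m (Suc l)" "c \<cdot> d - c \<cdot> y \<in> socle_series k"
          using step(1) brace_ideal_mult_left[OF I, of "d - y" c]
          by (simp_all add: left_series_Suc set_mult_sums_mem mult_diff_right)
        then show ?thesis by (auto simp: T_def)
      qed
    qed
  qed
  then have "bracket_series m t \<subseteq> T M" using assms by blast
  then show ?thesis using assms(2) by (auto simp: T_def)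
qed

lemma bracket_series_eventually_zero:
  assumes "socle_series K = UNIV" "M \<ge> 1" "left_series m M = {0}"
  shows "\<exists>n\<ge>1. bracket_series m n = {0}"
proof -
  have "\<exists>s\<ge>1. \<forall>j\<ge>s. bracket_series m j \<subseteq> socle_series (K - i)" if "i \<le> K" for i
    using that
  proof (induction i)
    case 0
    show ?case using assms(1) by auto
  next
    case (Suc i)
    then obtain s where s: "s \<ge> 1" "\<And>j. j \<ge> s \<Longrightarrow> bracket_series m j \<subseteq> socle_series (Suc (K - Suc i))"
      by (metis Suc_diff_Suc Suc_le_lessD Suc_leD)
    have "M * s \<ge> 1" using s(1) assms(2) by simp
    then show ?case using bracket_series_descent[OF assms(2,3) s] by blast
  qed
  from this[of K] obtain s where "s \<ge> 1" "bracket_series m s \<subseteq> {0}" by auto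
  then show ?thesis using zero_in_bracket_series[of s] by blast
qed

text \<open>
  The two-sided analogue of the socle series. Its factors are central in the adjoint group, which
  the factors of the socle series need not be.
\<close>

primrec annihilator_series :: "nat \<Rightarrow> 'a set" where
  "annihilator_series 0 = {0}"
| "annihilator_series (Suc k) =
     {a. \<forall>b. a \<cdot> b \<in> annihilator_series k \<and> b \<cdot> a \<in> annihilator_series k}"

lemma brace_ideal_annihilator:
  assumes I: "brace_ideal I"
  shows "brace_ideal {a. \<forall>b. a \<cdot> b \<in> I \<and> b \<cdot> a \<in> I}"
proof -
  have "(x - y) \<cdot> b \<in> I" if "\<forall>b. x \<cdot> b \<in> I" "\<forall>b. y \<cdot> b \<in> I" for x y b
    using brace_ideal_diff[OF brace_ideal_socle[OF I], of x y] that by auto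
  then show ?thesis
    unfolding brace_ideal_def
    using brace_ideal_zero[OF I] brace_ideal_diff[OF I]
      brace_ideal_mult_left[OF I] brace_ideal_mult_right[OF I]
    by (auto simp: mult_diff_right)
qed

lemma brace_ideal_annihilator_series: "brace_ideal (annihilator_series k)"
proof (induction k)
  case 0
  show ?case by (simp add: brace_ideal_def)
next
  case (Suc k)
  then show ?case by (simp add: brace_ideal_annihilator)
qed

lemma bracket_series_zero_imp_annihilator_series:
  assumes "n \<ge> 1" "bracket_series m n = {0}"
  shows "annihilator_series (n - 1) = UNIV"
proof -
  have "bracket_series m (n - i) \<subseteq> annihilator_series i" if "i < n" for i
    using that
  proof (induction i)
    case 0
    show ?case using assms by simp
  next
    case (Suc i)
    define j where "j = n - Suc i"
    have j: "j \<ge> 1" "n - i = Suc j" using Suc.prems by (simp_all add: j_def)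
    have "a \<cdot> b \<in> bracket_series m (Suc j)" "b \<cdot> a \<in> bracket_series m (Suc j)"
      if "a \<in> bracket_series m j" for a b
      using that set_mult_sums_subset_bracket[of 1 j] set_mult_sums_subset_bracket[of j 1] j(1)
        set_mult_sums_mem[of a "bracket_series m j" b UNIV]
        set_mult_sums_mem[of b UNIV a "bracket_series m j"]
      by auto
    then show ?case using Suc j unfolding j_def[symmetric] by auto
  qed
  from this[of "n - 1"] show ?thesis using assms(1) by auto
qed


section \<open>Nilpotency of the adjoint group\<close>

lemma subgroup_brace_ideal: "brace_ideal I \<Longrightarrow> subgroup I (adjoint_group m)"
  by (rule subgroup.intro) (simp_all add: brace_ideal_adj brace_ideal_adj_inv brace_ideal_zero)

text \<open>
  With \<open>x = h \<odot> g\<close> and \<open>y = g \<odot> h\<close> this places the commutator of \<open>h\<close> and \<open>g\<close> in every ideal that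
  contains \<open>h \<cdot> g - g \<cdot> h\<close>.
\<close>

lemma adj_adj_inv_in_ideal:
  assumes "brace_ideal I" "x - y \<in> I"
  shows "x \<odot> adj_inv y \<in> I"
proof -
  have "adj_inv (adj_inv x) \<odot> adj_inv y \<in> I"
    using assms by (simp only: cong_iff_adj adj_inv_cong cong_sym)
  then show ?thesis by simp
qed

lemma adj_diff_swap: "a \<odot> b - b \<odot> a = a \<cdot> b - b \<cdot> a"
  by (simp add: circ_def)

lemma subgroup_lower_central: "subgroup (lower_central (adjoint_group m) k) (adjoint_group m)"
proof (cases k)
  case 0
  then show ?thesis using group.subgroup_self[OF adjoint] by simp
next
  case (Suc n)
  then show ?thesis
    by (simp del: adjoint_group_simps(2,3)) (rule group.generate_is_subgroup[OF adjoint], simp)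
qed

lemma annihilator_series_imp_nilpotent:
  assumes "annihilator_series K = UNIV"
  shows "nilpotent_group (adjoint_group m)"
proof -
  have "lower_central (adjoint_group m) i \<subseteq> annihilator_series (K - i)" if "i \<le> K" for i
    using that
  proof (induction i)
    case 0
    show ?case using assms by simp
  next
    case (Suc i)
    define k where "k = K - Suc i"
    have k: "K - i = Suc k" using Suc.prems by (simp add: k_def)
    note I = brace_ideal_annihilator_series[of k]
    have "h \<odot> g \<odot> adj_inv h \<odot> adj_inv g \<in> annihilator_series k"
      if "h \<in> lower_central (adjoint_group m) i" for h g
    proof -
      have "h \<in> annihilator_series (Suc k)" using that Suc k by auto
      then have "h \<odot> g - g \<odot> h \<in> annihilator_series k"
        by (simp add: adj_diff_swap brace_ideal_diff[OF I])
      from adj_adj_inv_in_ideal[OF I this] show ?thesis by (simp add: adj_inv_adj adj_assoc)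
    qed
    then show ?case unfolding k_def[symmetric] lower_central.simps
      by (intro group.generate_subgroup_incl[OF adjoint _ subgroup_brace_ideal[OF I]]) auto
  qed
  from this[of K] have "lower_central (adjoint_group m) K \<subseteq> {0}" by simp
  moreover have "0 \<in> lower_central (adjoint_group m) K"
    using subgroup.one_closed[OF subgroup_lower_central] by simp
  ultimately show ?thesis unfolding nilpotent_group_def using adjoint by auto
qed

text \<open>
  On \<open>S\<^sub>k\<^sub>+\<^sub>1\<close> modulo \<open>S\<^sub>k\<close>, addition and the circle operation agree, so the elements of \<open>S\<^sub>k\<^sub>+\<^sub>1\<close>
  that are congruent to members of the \<open>j\<close>-th lower central term form an additive submonoid, \<open>D j\<close>.
  Left multiplication by any \<open>a\<close> sends \<open>g\<close> to the inverse of its commutator with \<open>a\<close> modulo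
  \<open>S\<^sub>k\<close>, hence \<open>D j\<close> into \<open>D (Suc j)\<close>.
\<close>

lemma left_series_descent:
  assumes c: "lower_central (adjoint_group m) c = {0}"
    and q: "q \<ge> 1" "left_series m q \<subseteq> socle_series (Suc k)"
  shows "left_series m (q + c) \<subseteq> socle_series k"
proof -
  note I = brace_ideal_socle_series[of k] and J = brace_ideal_socle_series[of "Suc k"]
  let ?G = "lower_central (adjoint_group m)"
  define D where "D j = {x. \<exists>g\<in>?G j. g \<in> socle_series (Suc k) \<and> x - g \<in> socle_series k}" for j
  have zero_G: "0 \<in> ?G j" for j
    using subgroup.one_closed[OF subgroup_lower_central] by simp
  have adj_G: "x \<odot> y \<in> ?G j" if "x \<in> ?G j" "y \<in> ?G j" for x y j
    using subgroup.m_closed[OF subgroup_lower_central that] by simp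
  have inv_G: "adj_inv x \<in> ?G j" if "x \<in> ?G j" for x j
    using subgroup.m_inv_closed[OF subgroup_lower_central that] by simp
  have zero_D: "0 \<in> D j" for j
    using zero_G[of j] brace_ideal_zero[OF I] brace_ideal_zero[OF J] by (force simp: D_def)
  have add_D: "x + y \<in> D j" if "x \<in> D j" "y \<in> D j" for x y j
  proof -
    obtain g h where g: "g \<in> ?G j" "g \<in> socle_series (Suc k)" "x - g \<in> socle_series k"
      and h: "h \<in> ?G j" "h \<in> socle_series (Suc k)" "y - h \<in> socle_series k"
      using \<open>x \<in> D j\<close> \<open>y \<in> D j\<close> by (auto simp only: D_def)
    have "(x + y) - g \<odot> h = (x - g) + (y - h) - g \<cdot> h" by (simp add: circ_def)
    also have "\<dots> \<in> socle_series k"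
      using g(2) by (intro brace_ideal_diff[OF I] brace_ideal_add[OF I] g(3) h(3)) simp
    finally show ?thesis
      using adj_G[OF g(1) h(1)] brace_ideal_adj[OF J g(2) h(2)] by (auto simp only: D_def)
  qed
  have mult_D: "a \<cdot> x \<in> D (Suc j)" if "x \<in> D j" for a x j
  proof -
    obtain g where g: "g \<in> ?G j" "g \<in> socle_series (Suc k)" "x - g \<in> socle_series k"
      using \<open>x \<in> D j\<close> by (auto simp only: D_def)
    \<comment> \<open>the inverse of the commutator of \<open>g\<close> and \<open>a\<close>, written as a quotient of two products\<close>
    define d where "d = a \<odot> g \<odot> adj_inv (g \<odot> a)"
    have "d = adj_inv (g \<odot> a \<odot> adj_inv g \<odot> adj_inv a)"
      by (simp add: d_def adj_inv_adj adj_assoc)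
    moreover have "g \<odot> a \<odot> adj_inv g \<odot> adj_inv a \<in> ?G (Suc j)"
      unfolding lower_central.simps by (rule generate.incl) (use g(1) in auto)
    ultimately have "d \<in> ?G (Suc j)" using inv_G by metis
    moreover have dJ: "d \<in> socle_series (Suc k)" unfolding d_def
      using g(2) brace_ideal_diff[OF J] brace_ideal_mult_left[OF J] brace_ideal_mult_right[OF J]
      by (intro adj_adj_inv_in_ideal[OF J]) (simp only: adj_diff_swap)
    moreover have "a \<cdot> x - d \<in> socle_series k"
    proof -
      have "a \<odot> g = d \<odot> (g \<odot> a)" by (simp add: d_def adj_assoc)
      then have "a \<cdot> g - d = g \<cdot> a + d \<cdot> (g \<odot> a)"
        unfolding circ_def[of m a g] circ_def[of m d] by (simp add: circ_def[of m g a] algebra_simps)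
      also have "\<dots> \<in> socle_series k" using g(2) dJ by (auto intro: brace_ideal_add[OF I])
      finally have "a \<cdot> g - d \<in> socle_series k" .
      moreover have "a \<cdot> x - a \<cdot> g \<in> socle_series k"
        using brace_ideal_mult_left[OF I g(3), of a] by (simp add: mult_diff_right)
      ultimately show ?thesis using cong_trans[OF I] by blast
    qed
    ultimately show ?thesis by (auto simp only: D_def)
  qed
  have "left_series m (q + j) \<subseteq> D j" for j
  proof (induction j)
    case 0
    have "x \<in> D 0" if "x \<in> socle_series (Suc k)" for x
      unfolding D_def by (rule CollectI, rule bexI[of _ x]) (use that brace_ideal_zero[OF I] in simp_all)
    then show ?case using q(2) by auto
  next
    case (Suc j)
    have "left_series m (q + Suc j) = set_mult_sums m UNIV (left_series m (q + j))"
      using q(1) by (simp add: left_series_Suc)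
    also have "\<dots> \<subseteq> D (Suc j)"
      using Suc by (intro set_mult_sums_subset zero_D add_D mult_D) auto
    finally show ?case .
  qed
  from this[of c] show ?thesis using c by (auto simp: D_def)
qed

lemma left_series_eventually_zero:
  assumes "socle_series K = UNIV" "nilpotent_group (adjoint_group m)"
  shows "\<exists>n\<ge>1. left_series m n = {0}"
proof -
  obtain c where c: "lower_central (adjoint_group m) c = {0}"
    using assms(2) by (auto simp: nilpotent_group_def)
  have "\<exists>q\<ge>1. left_series m q \<subseteq> socle_series (K - i)" if "i \<le> K" for i
    using that
  proof (induction i)
    case 0
    show ?case using assms(1) by auto
  next
    case (Suc i)
    then obtain q where "q \<ge> 1" "left_series m q \<subseteq> socle_series (Suc (K - Suc i))"
      by (metis Suc_diff_Suc Suc_le_lessD Suc_leD)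
    from this(1) left_series_descent[OF c this] show ?case by (meson le_add1 order_trans)
  qed
  from this[of K] obtain q where "q \<ge> 1" "left_series m q \<subseteq> {0}" by auto
  then show ?thesis using zero_in_left_series[of q] by blast
qed


section \<open>The associated solution and its retractions\<close>

definition rho :: "'a \<Rightarrow> 'a \<Rightarrow> 'a" where
  "rho y x = lam (adj_inv (lam x y)) x"

lemma brace_solution_eq: "brace_solution m (x, y) = (lam x y, rho y x)"
  by (simp add: brace_solution_def lam_def rho_def Let_def)

lemma sigma_brace_solution [simp]: "sigma (brace_solution m) x y = lam x y"
  and gamma_brace_solution [simp]: "gamma (brace_solution m) y x = rho y x"
  by (simp_all add: sigma_def gamma_def brace_solution_eq)

text \<open>
  The solution preserves the circle product. Together with the fact that \<open>lam\<close> is a left action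
  and \<open>rho\<close> a right action (\<open>rho_adj\<close>), this yields the braid relation: the outer components of the
  two sides agree by the action laws, and the middle ones by cancellation.
\<close>

lemma lam_adj_rho: "lam x y \<odot> rho y x = x \<odot> y"
  by (simp add: adj_eq rho_def add.commute)

lemma rho_eq: "rho y x = adj_inv (lam x y) \<odot> (x \<odot> y)"
  by (simp only: adj_inv_cancel flip: lam_adj_rho[of x y])

text \<open>
  The compatibility of the two actions, from which \<open>rho\<close> inherits its action law.
\<close>

lemma lam_adj_right: "lam x (y \<odot> z) = lam x y \<odot> lam (rho y x) z"
  by (simp add: adj_eq[of y] adj_eq[of "lam x y"] lam_add lam_adj_rho flip: lam_adj)

lemma rho_adj: "rho (y \<odot> z) x = rho z (rho y x)"
  unfolding rho_eq[of "y \<odot> z"] rho_eq[of z]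
  by (simp add: lam_adj_right adj_inv_adj rho_eq adj_assoc)

lemma rho_zero [simp]: "rho 0 x = x"
  using adj_inv_cancel(1)[of 0 x] by (simp add: rho_eq)

lemma nondegenerate_involutive_brace_solution:
  "nondegenerate_involutive_solution UNIV (brace_solution m)"
proof
  show "brace_solution m \<in> UNIV \<times> UNIV \<rightarrow> UNIV \<times> UNIV" by simp
next
  fix t :: "'a \<times> 'a \<times> 'a"
  obtain x y z where t: "t = (x, y, z)" by (cases t)
  define p where "p = lam x (lam y z)"
  define w where "w = rho z (rho y x)"
  have p: "lam (lam x y) (lam (rho y x) z) = p"
    by (simp add: p_def lam_adj_rho flip: lam_adj)
  have w: "rho (rho z y) (rho (lam y z) x) = w"
    by (simp add: w_def lam_adj_rho flip: rho_adj)
  have "p \<odot> (rho (lam (rho y x) z) (lam x y) \<odot> w) = x \<odot> (y \<odot> z)"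
    unfolding p[symmetric] w_def
    by (simp only: adj_assoc[symmetric] lam_adj_rho) (simp only: adj_assoc lam_adj_rho, simp only: adj_assoc[symmetric] lam_adj_rho)
  moreover have "p \<odot> (lam (rho (lam y z) x) (rho z y) \<odot> w) = x \<odot> (y \<odot> z)"
    unfolding w[symmetric] lam_adj_rho unfolding p_def
    by (simp only: adj_assoc[symmetric] lam_adj_rho) (simp only: adj_assoc lam_adj_rho)
  ultimately have "rho (lam (rho y x) z) (lam x y) \<odot> w = lam (rho (lam y z) x) (rho z y) \<odot> w"
    by (metis adj_left_cancel)
  then have "rho (lam (rho y x) z) (lam x y) = lam (rho (lam y z) x) (rho z y)"
    by (metis adj_assoc adj_inv(2) adj_zero(2))
  then show "on12 (brace_solution m) (on23 (brace_solution m) (on12 (brace_solution m) t)) =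
      on23 (brace_solution m) (on12 (brace_solution m) (on23 (brace_solution m) t))"
    by (simp add: t on12_def on23_def p w) (simp add: p_def w_def)
next
  fix p :: "'a \<times> 'a"
  obtain x y where p: "p = (x, y)" by (cases p)
  have x: "lam (lam x y) (rho y x) = x" by (simp add: rho_def)
  have "rho (rho y x) (lam x y) = y" unfolding rho_eq[of "rho y x"] x by (simp add: lam_adj_rho)
  with x show "brace_solution m (brace_solution m p) = p" by (simp add: p brace_solution_eq)
next
  fix x :: 'a
  have "bij (lam x)"
    by (rule bij_betw_byWitness[where f' = "lam (adj_inv x)"]) auto
  then show "bij_betw (sigma (brace_solution m) x) UNIV UNIV"
    by (metis (no_types) ext sigma_brace_solution)
next
  fix y :: 'a
  have "bij (rho y)"
    by (rule bij_betw_byWitness[where f' = "rho (adj_inv y)"]) (auto simp flip: rho_adj)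
  then show "bij_betw (gamma (brace_solution m) y) UNIV UNIV"
    by (metis (no_types) ext gamma_brace_solution)
qed

lemma rho_cong:
  assumes "brace_ideal I" "x - x' \<in> I" "y - y' \<in> I"
  shows "rho y x - rho y' x' \<in> I"
  unfolding rho_def by (intro lam_cong adj_inv_cong assms)

definition coset :: "nat \<Rightarrow> 'a \<Rightarrow> 'a set" where
  "coset k x = {y. y - x \<in> socle_series k}"

lemma coset_eq_iff: "coset k x = coset k y \<longleftrightarrow> x - y \<in> socle_series k"
proof
  note I = brace_ideal_socle_series[of k]
  assume "coset k x = coset k y"
  moreover have "x \<in> coset k x" using brace_ideal_zero[OF I] by (simp add: coset_def)
  ultimately show "x - y \<in> socle_series k" by (simp add: coset_def)
next
  note I = brace_ideal_socle_series[of k]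
  assume xy: "x - y \<in> socle_series k"
  then have yx: "y - x \<in> socle_series k" by (rule cong_sym[OF I])
  show "coset k x = coset k y"
    using cong_trans[OF I _ xy] cong_trans[OF I _ yx] by (auto simp: coset_def)
qed

text \<open>
  The retraction relation on the quotient by \<open>S\<^sub>k\<close> is congruence modulo \<open>S\<^sub>k\<^sub>+\<^sub>1\<close>.
\<close>

lemma mem_socle_series_Suc_diff:
  "x - y \<in> socle_series (Suc k) \<longleftrightarrow> (\<forall>z. lam x z - lam y z \<in> socle_series k)"
proof -
  note I = brace_ideal_socle_series[of k]
  have "x - y \<in> socle_series (Suc k) \<longleftrightarrow> adj_inv y \<odot> x \<in> socle_series (Suc k)"
    by (simp only: cong_iff_adj brace_ideal_socle_series)
  also have "\<dots> \<longleftrightarrow> (\<forall>z. lam (adj_inv y \<odot> x) z - z \<in> socle_series k)"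
    by (simp add: lam_def)
  also have "\<dots> \<longleftrightarrow> (\<forall>z. lam (adj_inv y) (lam x z - lam y z) \<in> socle_series k)"
    by (simp add: lam_adj lam_diff)
  finally show ?thesis by (simp only: brace_ideal_lam_iff[OF I])
qed

text \<open>
  The blocks of the \<open>k\<close>-th retraction are the additive cosets of \<open>S\<^sub>k\<close>. The maps have to be carried
  along in the induction, since the next relation depends on them; they are determined only on
  cosets, where congruence modulo an ideal makes them well defined.
\<close>

lemma ret_iter_brace_solution:
  "fst (ret_iter k (UNIV, brace_solution m)) = range (coset k) \<and>
   (\<forall>x y. snd (ret_iter k (UNIV, brace_solution m)) (coset k x, coset k y)
          = (coset k (lam x y), coset k (rho y x)))"
proof (induction k)
  case 0
  have "coset 0 x = {x}" for x by (auto simp: coset_def)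
  moreover have "inv_into UNIV (\<lambda>x. {x}) {x} = x" for x :: 'a
    by (rule inv_f_eq) (simp_all add: inj_def)
  ultimately show ?case
    by (simp add: transport_def brace_solution_eq)
next
  case (Suc k)
  define S where "S = ret_iter k (UNIV, brace_solution m)"
  define P where "P = fst S"
  define r where "r = snd S"
  define R where "R = ret_rel P r"
  \<comment> \<open>the retraction class of the coset of \<open>x\<close>, a set of cosets with union a coset of the next term\<close>
  define cl where "cl x = R `` {coset k x}" for x
  have P: "P = range (coset k)" and r: "r (coset k x, coset k y) = (coset k (lam x y), coset k (rho y x))" for x y
    using Suc by (simp_all add: P_def r_def S_def)
  have R: "(coset k x, coset k y) \<in> R \<longleftrightarrow> x - y \<in> socle_series (Suc k)" for x y
  proof -
    have mem: "coset k z \<in> P" for z by (simp only: P rangeI)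
    have "(coset k x, coset k y) \<in> R \<longleftrightarrow>
        (\<forall>C\<in>P. sigma r (coset k x) C = sigma r (coset k y) C)"
      by (simp add: R_def ret_rel_def mem)
    also have "\<dots> \<longleftrightarrow> (\<forall>z. coset k (lam x z) = coset k (lam y z))"
      unfolding P sigma_def by (simp add: r)
    finally have "(coset k x, coset k y) \<in> R \<longleftrightarrow> (\<forall>z. coset k (lam x z) = coset k (lam y z))" .
    then show ?thesis by (simp only: mem_socle_series_Suc_diff coset_eq_iff)
  qed
  have equiv: "equiv P R" unfolding R_def by (rule equiv_ret_rel)
  have R_iff: "(coset k x, C) \<in> R \<longleftrightarrow> (\<exists>y. C = coset k y \<and> x - y \<in> socle_series (Suc k))" for x C
  proof -
    have "C \<in> range (coset k)" if "(coset k x, C) \<in> R"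
      using that unfolding R_def ret_rel_def P[symmetric] by blast
    then show ?thesis using R by blast
  qed
  have cl_eq: "cl x = {coset k y |y. x - y \<in> socle_series (Suc k)}" for x
    unfolding cl_def using R_iff by blast
  have cl_cong: "cl x = cl y" if "x - y \<in> socle_series (Suc k)" for x y
    unfolding cl_def using that R equiv_class_eq[OF equiv] by blast
  have quot: "P // R = range cl" unfolding quotient_def cl_def P by blast
  have Un: "\<Union>(cl x) = coset (Suc k) x" for x
  proof -
    note J = brace_ideal_socle_series[of "Suc k"]
    show ?thesis
    proof (intro equalityI subsetI)
      fix z assume "z \<in> \<Union>(cl x)"
      then obtain y where "x - y \<in> socle_series (Suc k)" "z - y \<in> socle_series k"
        unfolding cl_eq coset_def by blast
      then have "z - y \<in> socle_series (Suc k)" "y - x \<in> socle_series (Suc k)"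
        using socle_series_mono cong_sym[OF J] by blast+
      then show "z \<in> coset (Suc k) x" using cong_trans[OF J] unfolding coset_def by blast
    next
      fix z assume "z \<in> coset (Suc k) x"
      then have "x - z \<in> socle_series (Suc k)" using cong_sym[OF J] unfolding coset_def by blast
      then have "coset k z \<in> cl x" unfolding cl_eq by blast
      moreover have "z \<in> coset k z" using brace_ideal_zero[OF brace_ideal_socle_series] by (simp add: coset_def)
      ultimately show "z \<in> \<Union>(cl x)" by blast
    qed
  qed
  have ret_snd: "snd (ret S) (cl x, cl y) = (cl (lam x y), cl (rho y x))" for x y
  proof -
    note J = brace_ideal_socle_series[of "Suc k"]
    have refl: "coset k z \<in> cl z" for z using brace_ideal_zero[OF J] by (force simp only: cl_eq diff_self)
    have "R `` {sigma r C D} = cl (lam x y) \<and> R `` {gamma r D C} = cl (rho y x)"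
      if CD: "C \<in> cl x" "D \<in> cl y" for C D
    proof -
      obtain x' y' where C: "C = coset k x'" "x - x' \<in> socle_series (Suc k)"
        and D: "D = coset k y'" "y - y' \<in> socle_series (Suc k)"
        using CD unfolding cl_eq by blast
      have "R `` {sigma r C D} = cl (lam x' y')" "R `` {gamma r D C} = cl (rho y' x')"
        by (simp_all add: sigma_def gamma_def C D r cl_def)
      then show ?thesis
        using cl_cong[OF lam_cong[OF J C(2) D(2)]] cl_cong[OF rho_cong[OF J C(2) D(2)]] by simp
    qed
    moreover have "snd (ret S) (cl x, cl y) =
        (\<Union>C\<in>cl x. \<Union>D\<in>cl y. R `` {sigma r C D}, \<Union>C\<in>cl x. \<Union>D\<in>cl y. R `` {gamma r D C})"
      by (simp add: ret_def R_def P_def r_def split_beta)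
    ultimately show ?thesis using refl[of x] refl[of y] by auto
  qed
  have ret_fst: "fst (ret S) = range cl" by (simp add: fst_ret quot flip: P_def r_def R_def)
  have inv: "inv_into (range cl) Union (coset (Suc k) x) = cl x" for x
    using inj_on_Union_ret[of k "(UNIV, brace_solution m)"]
    by (simp add: ret_fst inv_into_f_f flip: Un S_def)
  have "ret_iter (Suc k) (UNIV, brace_solution m) = transport Union (ret S)"
    by (simp add: S_def)
  then show ?case
    by (simp add: transport_def split_beta ret_fst inv ret_snd Un image_image)
qed

lemma multipermutation_brace_solution_iff_socle_series:
  "multipermutation_solution UNIV (brace_solution m) \<longleftrightarrow> (\<exists>k. socle_series k = UNIV)"
proof -
  have "card (range (coset k)) = 1 \<longleftrightarrow> socle_series k = UNIV" for k
  proof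
    assume "card (range (coset k)) = 1"
    then obtain C where "range (coset k) = {C}" by (auto simp: card_1_singleton_iff)
    then have "coset k x = coset k 0" for x by (metis rangeI singletonD)
    then show "socle_series k = UNIV" by (auto simp: coset_eq_iff)
  next
    assume "socle_series k = UNIV"
    then have "range (coset k) = {UNIV}" by (auto simp: coset_def)
    then show "card (range (coset k)) = 1" by simp
  qed
  then show ?thesis
    by (simp add: multipermutation_solution_def nondegenerate_involutive_brace_solution
        ret_iter_brace_solution)
qed

end

theorem theorem3:
  fixes m :: "'a::ab_group_add \<Rightarrow> 'a \<Rightarrow> 'a"
  assumes "left_brace m"
  shows "((\<exists>n\<ge>1. right_series m n = {0}) \<and> (\<exists>k\<ge>1. left_series m k = {0})
            \<longleftrightarrow> (\<exists>n\<ge>1. bracket_series m n = {0}))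
       \<and> ((\<exists>n\<ge>1. bracket_series m n = {0})
            \<longleftrightarrow> (\<exists>n\<ge>1. right_series m n = {0}) \<and> nilpotent_group (adjoint_group m))
       \<and> ((\<exists>n\<ge>1. right_series m n = {0}) \<and> nilpotent_group (adjoint_group m)
            \<longleftrightarrow> nilpotent_group (adjoint_group m)
                \<and> multipermutation_solution (UNIV :: 'a set) (brace_solution m))"
proof -
  interpret left_brace m by (rule assms)
  let ?right = "\<exists>n\<ge>1. right_series m n = {0}" and ?left = "\<exists>k\<ge>1. left_series m k = {0}"
    and ?bracket = "\<exists>n\<ge>1. bracket_series m n = {0}"
  have one_two: "?right \<and> ?left \<longrightarrow> ?bracket"
    using right_series_zero_iff_socle_series bracket_series_eventually_zero by blast
  have "?bracket \<longrightarrow> ?right"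
    using right_series_subset_bracket_series zero_in_right_series by blast
  moreover have "?bracket \<longrightarrow> ?left"
    using left_series_subset_bracket_series zero_in_left_series by blast
  moreover have "?bracket \<longrightarrow> nilpotent_group (adjoint_group m)"
    using bracket_series_zero_imp_annihilator_series annihilator_series_imp_nilpotent by blast
  moreover have "?right \<and> nilpotent_group (adjoint_group m) \<longrightarrow> ?left"
    using right_series_zero_iff_socle_series left_series_eventually_zero by blast
  moreover have "?right \<longleftrightarrow> multipermutation_solution (UNIV :: 'a set) (brace_solution m)"
    using right_series_zero_iff_socle_series multipermutation_brace_solution_iff_socle_series by simp
  ultimately show ?thesis using one_two by argo
qed

end
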